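(* For every non-negative integer $n$ and every integer $s$, \[ \sum_{k = 0}^{\lfloor n/2 \rfloor} \binom {n}{2k} \frac{F_{2k + s}}{4^k} =\frac{1}{2^{n+1}} \begin{cases} (-1)^{s+1} F_{2n - s} + 5^{n/2}F_{n+s}, & \text{$n$ even;}\\ (-1)^{s+1} F_{2n - s} + 5^{(n-1)/2}L_{n+s}, & \text{$n$ odd,} \end{cases} \] \[ \sum_{k = 0}^{\lfloor n/2 \rfloor} \binom {n}{2k} \frac{L_{2k + s}}{4^{k}}=\frac{1}{2^{n+1}} \begin{cases} (-1)^s L_{2n - s} + 5^{n/2}L_{n+s}, & \text{$n$ even;}\\(-1)^s L_{2n - s} + 5^{(n+1)/2}F_{n+s}, & \text{$n$ odd.} \end{cases} \]
   Context: The Fibonacci numbers $F_j$ and Lucas numbers $L_j$ are defined for all integers $j$ by $F_0=0$, $F_1=1$, $L_0=2$, $L_1=1$, $F_j=F_{j-1}+F_{j-2}$, $L_j=L_{j-1}+L_{j-2}$, with $F_{-j}=(-1)^{j-1}F_j$ and $L_{-j}=(-1)^jL_j$. *)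

theory Defs
  imports Complex_Main "HOL-Number_Theory.Fib"
begin

fun lucas :: "nat \<Rightarrow> nat" where
  "lucas 0 = 2"
| "lucas (Suc 0) = 1"
| "lucas (Suc (Suc n)) = lucas (Suc n) + lucas n"

text \<open>For a negative index \<open>- m\<close> with \<open>m \<ge> 1\<close>, \<open>nat (- j)\<close> is \<open>m\<close>, so the
  subtraction in the exponent does not truncate.\<close>

definition fibZ :: "int \<Rightarrow> int" where
  "fibZ j = (if j \<ge> 0 then int (fib (nat j))
             else (- 1) ^ (nat (- j) - 1) * int (fib (nat (- j))))"

definition lucasZ :: "int \<Rightarrow> int" where
  "lucasZ j = (if j \<ge> 0 then int (lucas (nat j))
               else (- 1) ^ nat (- j) * int (lucas (nat (- j))))"

lemma fibZ_of_nat: "fibZ (int n) = int (fib n)"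
  by (simp add: fibZ_def)

lemma fibZ_neg_Suc: "fibZ (- int (Suc n)) = (- 1) ^ n * int (fib (Suc n))"
  unfolding fibZ_def by (simp del: of_nat_Suc fib.simps)

lemma lucasZ_of_nat: "lucasZ (int n) = int (lucas n)"
  by (simp add: lucasZ_def)

lemma lucasZ_neg_of_nat: "lucasZ (- int n) = (- 1) ^ n * int (lucas n)"
  by (cases n) (simp_all add: lucasZ_def del: of_nat_Suc lucas.simps(3))

lemma int_index_cases:
  fixes j :: int
  obtains (nonneg) m where "j = int (Suc (Suc m))" | (one) "j = 1" | (zero) "j = 0"
  | (neg) m where "j = - int (Suc m)"
proof -
  consider "j \<ge> 2" | "j = 1" | "j = 0" | "j < 0" by linarith
  then show thesis
  proof cases
    case 1
    then have "j = int (Suc (Suc (nat (j - 2))))" by simp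
    then show ?thesis by (rule nonneg)
  next
    case 4
    then have "j = - int (Suc (nat (- j - 1)))" by simp
    then show ?thesis by (rule neg)
  qed (use one zero in auto)
qed

lemma fibZ_rec: "fibZ j = fibZ (j - 1) + fibZ (j - 2)"
proof (cases j rule: int_index_cases)
  case (nonneg m)
  have "j - 1 = int (Suc m)" "j - 2 = int m" using nonneg by auto
  then show ?thesis using nonneg by (simp only: fibZ_of_nat) simp
next
  case (neg m)
  have "j - 1 = - int (Suc (Suc m))" "j - 2 = - int (Suc (Suc (Suc m)))" using neg by auto
  then show ?thesis using neg by (simp only: fibZ_neg_Suc) (simp add: algebra_simps)
qed (simp_all add: fibZ_def)

lemma lucasZ_rec: "lucasZ j = lucasZ (j - 1) + lucasZ (j - 2)"
proof (cases j rule: int_index_cases)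
  case (nonneg m)
  have "j - 1 = int (Suc m)" "j - 2 = int m" using nonneg by auto
  then show ?thesis using nonneg by (simp only: lucasZ_of_nat) simp
next
  case (neg m)
  have "j - 1 = - int (Suc (Suc m))" "j - 2 = - int (Suc (Suc (Suc m)))" using neg by auto
  then show ?thesis using neg by (simp only: lucasZ_neg_of_nat) (simp add: algebra_simps)
qed (simp_all add: lucasZ_def numeral_2_eq_2)

end

theory Submission
  imports Defs
begin

text \<open>
  The sum over even indices is half the sum of the binomial transforms
  \<open>\<Sum>k. (n choose k) c^k G (s + k)\<close> at \<open>c = 1/2\<close> and \<open>c = -1/2\<close>. By Pascal's rule, raising \<open>n\<close> by one
  applies \<open>1 + c E\<close> to \<open>G\<close>, where \<open>E\<close> is the index shift. On solutions of the Fibonacci recurrence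
  \<open>1 - E/2\<close> is half a shift by \<open>-2\<close>, whereas \<open>1 + E/2\<close> is half a shift by \<open>1\<close> that exchanges
  \<open>(F, L)\<close> for \<open>(L, 5 F)\<close>, which explains the powers of 5 and the parity distinction.
\<close>

text \<open>Adding the alternating sum doubles the even-indexed terms and cancels the odd-indexed
  ones. In the induction a new term enters the left side exactly when \<open>Suc n\<close> is
  even.\<close>

lemma sum_even_indices:
  fixes f :: "nat \<Rightarrow> real"
  shows "(\<Sum>k = 0..n div 2. f (2 * k)) = ((\<Sum>k\<le>n. f k) + (\<Sum>k\<le>n. (- 1) ^ k * f k)) / 2"
proof (induction n)
  case 0
  show ?case by simp
next
  case (Suc n)
  show ?case
  proof (cases "even n")
    case True
    then have "Suc n div 2 = n div 2" by presburger
    then show ?thesis using Suc True by simp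
  next
    case False
    then have "Suc n div 2 = Suc (n div 2)" and "2 * Suc (n div 2) = Suc n" by presburger+
    then show ?thesis using Suc False by (simp add: field_simps)
  qed
qed

lemma binomial_transform_Suc:
  fixes G :: "int \<Rightarrow> real"
  shows "(\<Sum>k\<le>Suc n. real (Suc n choose k) * (c ^ k * G (int k + s)))
       = (\<Sum>k\<le>n. real (n choose k) * (c ^ k * G (int k + s)))
         + c * (\<Sum>k\<le>n. real (n choose k) * (c ^ k * G (int k + (s + 1))))"
proof -
  have "(\<Sum>k\<le>Suc n. real (Suc n choose k) * (c ^ k * G (int k + s)))
      = G s + (\<Sum>k\<le>n. real (n choose Suc k) * (c ^ Suc k * G (int (Suc k) + s)))
        + (\<Sum>k\<le>n. real (n choose k) * (c ^ Suc k * G (int (Suc k) + s)))"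
    by (subst sum.atMost_Suc_shift) (simp add: sum.distrib algebra_simps)
  \<comment> \<open>\<open>G s\<close> is the term \<open>k = 0\<close>, and the term
    \<open>k = Suc n\<close> is zero because \<open>n choose Suc n = 0\<close>; hence this part is
    the transform for \<open>n\<close>.\<close>
  also have "G s + (\<Sum>k\<le>n. real (n choose Suc k) * (c ^ Suc k * G (int (Suc k) + s)))
      = (\<Sum>k\<le>Suc n. real (n choose k) * (c ^ k * G (int k + s)))"
    by (subst sum.atMost_Suc_shift) simp
  also have "\<dots> = (\<Sum>k\<le>n. real (n choose k) * (c ^ k * G (int k + s)))"
    by simp
  also have "(\<Sum>k\<le>n. real (n choose k) * (c ^ Suc k * G (int (Suc k) + s)))
      = c * (\<Sum>k\<le>n. real (n choose k) * (c ^ k * G (int k + (s + 1))))"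
    by (simp add: sum_distrib_left algebra_simps)
  finally show ?thesis .
qed

lemma binomial_transform_minus_half:
  fixes G :: "int \<Rightarrow> real"
  assumes rec: "\<And>j. G j = G (j - 1) + G (j - 2)"
  shows "(\<Sum>k\<le>n. real (n choose k) * ((- 1 / 2) ^ k * G (int k + s))) = G (s - 2 * int n) / 2 ^ n"
proof (induction n arbitrary: s)
  case 0
  show ?case by simp
next
  case (Suc n)
  define t where "t = s - 2 * int n"
  \<comment> \<open>This is the operator identity for \<open>1 - E/2\<close>:
    \<open>2 * G t - G (t + 1) = G t - G (t - 1) = G (t - 2)\<close>.\<close>
  have "G (s + 1 - 2 * int n) = 2 * G t - G (t - 2)"
    using rec[of "t + 1"] rec[of t] by (simp add: t_def algebra_simps)
  moreover have "s - 2 * int (Suc n) = t - 2"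
    by (simp add: t_def)
  ultimately show ?case
    unfolding binomial_transform_Suc Suc by (simp add: t_def[symmetric] field_simps)
qed

text \<open>Two consecutive zeros propagate in both directions. A linear identity between solutions
  of the recurrence thus needs checking at two indices only.\<close>

lemma fibonacci_recurrence_eq_0:
  fixes D :: "int \<Rightarrow> int"
  assumes rec: "\<And>j. D j = D (j - 1) + D (j - 2)" and "D 0 = 0" "D 1 = 0"
  shows "D j = 0"
proof -
  have "D j = 0 \<and> D (j + 1) = 0"
  proof (induction j rule: int_induct[where k = 0])
    case base
    show ?case using assms(2,3) by simp
  next
    case (step1 i)
    then show ?case using rec[of "i + 2"] by (simp add: algebra_simps)
  next
    case (step2 i)
    then show ?case using rec[of "i + 1"] by (simp add: algebra_simps)
  qed
  then show ?thesis ..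
qed

lemma lucasZ_add_1: "lucasZ (j + 1) = 2 * fibZ j + fibZ (j + 1)"
proof -
  have "lucasZ (j + 1) - (2 * fibZ j + fibZ (j + 1)) = 0"
  proof (rule fibonacci_recurrence_eq_0[where D = "\<lambda>j. lucasZ (j + 1) - (2 * fibZ j + fibZ (j + 1))"])
    fix i
    show "lucasZ (i + 1) - (2 * fibZ i + fibZ (i + 1))
        = lucasZ (i - 1 + 1) - (2 * fibZ (i - 1) + fibZ (i - 1 + 1))
          + (lucasZ (i - 2 + 1) - (2 * fibZ (i - 2) + fibZ (i - 2 + 1)))"
      using lucasZ_rec[of "i + 1"] fibZ_rec[of i] fibZ_rec[of "i + 1"]
      by (simp add: algebra_simps)
  qed (simp_all add: fibZ_def lucasZ_def numeral_2_eq_2)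
  then show ?thesis by simp
qed

text \<open>Expressing both Lucas numbers through Fibonacci numbers turns the right side into
  \<open>4 * (fibZ (j - 1) + fibZ j) + fibZ (j + 1)\<close>.\<close>

lemma five_fibZ_add_1: "5 * fibZ (j + 1) = 2 * lucasZ j + lucasZ (j + 1)"
  using lucasZ_add_1[of j] lucasZ_add_1[of "j - 1"] fibZ_rec[of "j + 1"] by simp

text \<open>The definition of \<open>fibZ\<close> puts a sign on negative indices only, and for
  these the same sign appears twice on the right and cancels. The exponent may be negative, hence
  \<open>powi\<close>.\<close>

lemma fibZ_uminus: "real_of_int (fibZ (- j)) = (- 1) powi (j + 1) * real_of_int (fibZ j)"
proof (cases j rule: int_index_cases)
  case (neg m)
  have "(- 1 :: real) powi (j + 1) = (- 1) ^ m"
    using neg by (simp add: power_int_minus_left)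
  then show ?thesis
    using neg by (simp only: fibZ_neg_Suc minus_minus fibZ_of_nat) (simp flip: power_mult_distrib)
next
  case (nonneg m)
  have "(- 1 :: real) powi (j + 1) = (- 1) ^ Suc m"
    using nonneg by (simp add: power_int_minus_left)
  then show ?thesis
    using nonneg by (simp only: fibZ_neg_Suc fibZ_of_nat) simp
qed (simp_all add: fibZ_def)

lemma lucasZ_uminus: "real_of_int (lucasZ (- j)) = (- 1) powi j * real_of_int (lucasZ j)"
proof (cases "j \<ge> 0")
  case True
  then obtain m where "j = int m" by (metis nonneg_int_cases)
  then show ?thesis by (simp add: lucasZ_neg_of_nat lucasZ_of_nat)
next
  case False
  then obtain m where j: "j = - int m" by (metis nonpos_int_cases linorder_le_cases)
  have "(- 1 :: real) powi j = (- 1) ^ m"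
    using j by (simp add: power_int_minus_left)
  then show ?thesis
    using j by (simp add: lucasZ_neg_of_nat lucasZ_of_nat flip: power_mult_distrib)
qed

text \<open>Both formulas go through one induction, with \<open>s\<close> arbitrary because the step
  also uses \<open>s + 1\<close>.\<close>

lemma binomial_transform_half_fibZ_lucasZ:
  "(\<Sum>k\<le>n. real (n choose k) * ((1 / 2) ^ k * real_of_int (fibZ (int k + s))))
     = (if even n then 5 ^ (n div 2) * real_of_int (fibZ (int n + s))
        else 5 ^ ((n - 1) div 2) * real_of_int (lucasZ (int n + s))) / 2 ^ n
   \<and> (\<Sum>k\<le>n. real (n choose k) * ((1 / 2) ^ k * real_of_int (lucasZ (int k + s))))
     = (if even n then 5 ^ (n div 2) * real_of_int (lucasZ (int n + s))
        else 5 ^ ((n + 1) div 2) * real_of_int (fibZ (int n + s))) / 2 ^ n"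
proof (induction n arbitrary: s)
  case 0
  show ?case by simp
next
  case (Suc n)
  define t where "t = int n + s"
  have t: "int n + s = t" "int n + (s + 1) = t + 1" "int (Suc n) + s = t + 1"
    by (simp_all add: t_def)
  have L: "real_of_int (lucasZ (t + 1)) = 2 * real_of_int (fibZ t) + real_of_int (fibZ (t + 1))"
    by (simp add: lucasZ_add_1)
  have F: "5 * real_of_int (fibZ (t + 1)) = 2 * real_of_int (lucasZ t) + real_of_int (lucasZ (t + 1))"
    using five_fibZ_add_1[of t] by linarith
  note step = binomial_transform_Suc[where c = "1 / 2" and G = "\<lambda>j. real_of_int (fibZ j)"]
    binomial_transform_Suc[where c = "1 / 2" and G = "\<lambda>j. real_of_int (lucasZ j)"]
  have half: "x / 2 ^ n + 1 / 2 * (y / 2 ^ n) = z / 2 ^ Suc n" if "z = 2 * x + y" for x y z :: real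
    using that by (simp add: field_simps)
  note IH = Suc[THEN conjunct1] Suc[THEN conjunct2]
  show ?case
  proof (cases "even n")
    case True
    then obtain m where n: "n = 2 * m" by (elim evenE)
    have exps: "n div 2 = m" "(Suc n - 1) div 2 = m" "(Suc n + 1) div 2 = Suc m"
      using n by auto
    \<comment> \<open>For even \<open>n\<close> the Fibonacci sum passes to Lucas numbers by
      \<open>L\<close> without a new factor 5, while the Lucas sum gains one by
      \<open>F\<close>.\<close>
    have "5 ^ m * real_of_int (lucasZ (t + 1))
        = 2 * (5 ^ m * real_of_int (fibZ t)) + 5 ^ m * real_of_int (fibZ (t + 1))"
      unfolding L by (simp add: algebra_simps)
    moreover have "5 ^ Suc m * real_of_int (fibZ (t + 1))
        = 2 * (5 ^ m * real_of_int (lucasZ t)) + 5 ^ m * real_of_int (lucasZ (t + 1))"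
      using arg_cong[OF F, of "\<lambda>x. 5 ^ m * x"] by (simp add: algebra_simps)
    ultimately show ?thesis
      unfolding step IH t exps using True
      by (simp only: even_Suc if_True if_False not_True_eq_False not_False_eq_True half)
  next
    case False
    then obtain m where n: "n = Suc (2 * m)" by (metis oddE Suc_eq_plus1)
    have exps: "(n - 1) div 2 = m" "(n + 1) div 2 = Suc m" "Suc n div 2 = Suc m"
      using n by auto
    \<comment> \<open>For odd \<open>n\<close> the Fibonacci sum holds Lucas numbers, so now it is
      the one that gains the factor 5.\<close>
    have "5 ^ Suc m * real_of_int (fibZ (t + 1))
        = 2 * (5 ^ m * real_of_int (lucasZ t)) + 5 ^ m * real_of_int (lucasZ (t + 1))"
      using arg_cong[OF F, of "\<lambda>x. 5 ^ m * x"] by (simp add: algebra_simps)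
    moreover have "5 ^ Suc m * real_of_int (lucasZ (t + 1))
        = 2 * (5 ^ Suc m * real_of_int (fibZ t)) + 5 ^ Suc m * real_of_int (fibZ (t + 1))"
      unfolding L by (simp add: algebra_simps)
    ultimately show ?thesis
      unfolding step IH t exps using False
      by (simp only: even_Suc if_True if_False not_True_eq_False not_False_eq_True half)
  qed
qed

text \<open>Since \<open>4 ^ k = 2 ^ (2 * k)\<close>, the summands are the even-indexed terms of the
  transform at \<open>1 / 2\<close>; the alternating sign turns this into the transform at
  \<open>- 1 / 2\<close>.\<close>

lemma sum_even_binomial_transform:
  fixes G :: "int \<Rightarrow> real"
  assumes "\<And>j. G j = G (j - 1) + G (j - 2)"
  shows "(\<Sum>k = 0..n div 2. real (n choose (2 * k)) * (G (2 * int k + s) / 4 ^ k))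
       = ((\<Sum>k\<le>n. real (n choose k) * ((1 / 2) ^ k * G (int k + s))) + G (s - 2 * int n) / 2 ^ n) / 2"
proof -
  have "(\<Sum>k = 0..n div 2. real (n choose (2 * k)) * (G (2 * int k + s) / 4 ^ k))
      = (\<Sum>k = 0..n div 2. real (n choose (2 * k)) * ((1 / 2) ^ (2 * k) * G (int (2 * k) + s)))"
    by (simp add: power_mult power_divide)
  also have "\<dots> = ((\<Sum>k\<le>n. real (n choose k) * ((1 / 2) ^ k * G (int k + s)))
      + (\<Sum>k\<le>n. (- 1) ^ k * (real (n choose k) * ((1 / 2) ^ k * G (int k + s))))) / 2"
    by (rule sum_even_indices)
  also have "(\<Sum>k\<le>n. (- 1) ^ k * (real (n choose k) * ((1 / 2) ^ k * G (int k + s))))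
      = (\<Sum>k\<le>n. real (n choose k) * ((- 1 / 2) ^ k * G (int k + s)))"
    by (intro sum.cong refl) (simp add: power_divide power_minus[of "1 / 2"])
  also have "\<dots> = G (s - 2 * int n) / 2 ^ n"
    by (rule binomial_transform_minus_half) (rule assms)
  finally show ?thesis .
qed

theorem theorem12:
  fixes n :: nat and s :: int
  shows "(\<Sum>k = 0..n div 2. real (n choose (2 * k)) * (real_of_int (fibZ (2 * int k + s)) / 4 ^ k))
       = 1 / 2 ^ (n + 1) *
         (if even n
          then (- 1) powi (s + 1) * real_of_int (fibZ (2 * int n - s))
               + 5 ^ (n div 2) * real_of_int (fibZ (int n + s))
          else (- 1) powi (s + 1) * real_of_int (fibZ (2 * int n - s))
               + 5 ^ ((n - 1) div 2) * real_of_int (lucasZ (int n + s)))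
     \<and> (\<Sum>k = 0..n div 2. real (n choose (2 * k)) * (real_of_int (lucasZ (2 * int k + s)) / 4 ^ k))
       = 1 / 2 ^ (n + 1) *
         (if even n
          then (- 1) powi s * real_of_int (lucasZ (2 * int n - s))
               + 5 ^ (n div 2) * real_of_int (lucasZ (int n + s))
          else (- 1) powi s * real_of_int (lucasZ (2 * int n - s))
               + 5 ^ ((n + 1) div 2) * real_of_int (fibZ (int n + s)))"
proof -
  \<comment> \<open>Reflecting the index gives a sign with exponent
    \<open>2 * int n - s + 1\<close>, which has the parity of \<open>s + 1\<close>.\<close>
  have F: "real_of_int (fibZ (s - 2 * int n)) = (- 1) powi (s + 1) * real_of_int (fibZ (2 * int n - s))"
    using fibZ_uminus[of "2 * int n - s"] by (simp add: power_int_minus_left)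
  have L: "real_of_int (lucasZ (s - 2 * int n)) = (- 1) powi s * real_of_int (lucasZ (2 * int n - s))"
    using lucasZ_uminus[of "2 * int n - s"] by (simp add: power_int_minus_left)
  have recs: "real_of_int (fibZ j) = real_of_int (fibZ (j - 1)) + real_of_int (fibZ (j - 2))"
    "real_of_int (lucasZ j) = real_of_int (lucasZ (j - 1)) + real_of_int (lucasZ (j - 2))" for j
    using fibZ_rec[of j] lucasZ_rec[of j] by linarith+
  note sums = sum_even_binomial_transform[where G = "\<lambda>j. real_of_int (fibZ j)", OF recs(1)]
    sum_even_binomial_transform[where G = "\<lambda>j. real_of_int (lucasZ j)", OF recs(2)]
  show ?thesis
    unfolding sums binomial_transform_half_fibZ_lucasZ[THEN conjunct1]
      binomial_transform_half_fibZ_lucasZ[THEN conjunct2] F L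
    by (simp add: field_simps)
qed

end
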